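(* For every finite group $G$ of order $n$ and every ordering $A=(a_0,\dots,a_{n-1})$ of its elements, with $q_b=a_{b-1}a_b^{-1}$ for $b=1,\dots,n-1$, $$|\operatorname{Stab}(P(G,A))|\ \ge\ n+\sum_{b=1}^{n-1}\Bigl(2^{[G:\langle q_b\rangle]}-2\Bigr).$$
   Context: A strict complete profile consists of equally many men and women, each with a strict total order over all participants of the opposite side. A matching is a bijection $\mu$ from men to women. A pair $(m,w)$ blocks $\mu$ if $m$ prefers $w$ to $\mu(m)$ and $w$ prefers $m$ to $\mu^{-1}(w)$; $\mu$ is stable if no pair blocks it. $\operatorname{Stab}(S)$ is the set of stable matchings of a profile $S$. An ordering of $G$ is a tuple listing each element exactly once. The regular anti-phase template $P(G,A)$ is the profile with men $m_g$ and women $w_g$ indexed by $g\in G$ and lists $$m_g:\ w_{ga_0}\succ w_{ga_1}\succ\cdots\succ w_{ga_{n-1}},\qquad w_h:\ m_{ha_{n-1}^{-1}}\succ m_{ha_{n-2}^{-1}}\succ\cdots\succ m_{ha_0^{-1}}.$$ $[G:H]$ denotes the index of a subgroup $H$ in $G$. *)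

theory Defs
  imports "HOL-Algebra.Algebra"
begin

text \<open>
  A pair \<open>(w, w')\<close> in \<open>man_pref S m\<close> means that \<open>m\<close> strictly prefers \<open>w\<close> to \<open>w'\<close>; likewise for
  \<open>woman_pref\<close>.  Men and women are told apart by their role, so the types \<open>'m\<close> and \<open>'w\<close> may coincide.
\<close>

record ('m, 'w) profile =
  men :: "'m set"
  women :: "'w set"
  man_pref :: "'m \<Rightarrow> 'w rel"
  woman_pref :: "'w \<Rightarrow> 'm rel"

definition strict_complete_profile :: "('m, 'w) profile \<Rightarrow> bool" where
  "strict_complete_profile S \<longleftrightarrow>
     finite (men S) \<and> finite (women S) \<and> card (men S) = card (women S) \<and>
     (\<forall>m\<in>men S. man_pref S m \<subseteq> women S \<times> women S \<and>
        strict_linear_order_on (women S) (man_pref S m)) \<and>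
     (\<forall>w\<in>women S. woman_pref S w \<subseteq> men S \<times> men S \<and>
        strict_linear_order_on (men S) (woman_pref S w))"

text \<open>
  Matchings are represented by extensional functions (\<open>undefined\<close> outside the set of men), so that
  distinct functions are distinct matchings and counting them is meaningful.
\<close>

definition matchings :: "('m, 'w) profile \<Rightarrow> ('m \<Rightarrow> 'w) set" where
  "matchings S = {\<mu> \<in> extensional (men S). bij_betw \<mu> (men S) (women S)}"

definition blocks :: "('m, 'w) profile \<Rightarrow> ('m \<Rightarrow> 'w) \<Rightarrow> 'm \<Rightarrow> 'w \<Rightarrow> bool" where
  "blocks S \<mu> m w \<longleftrightarrow> m \<in> men S \<and> w \<in> women S \<and>
     (w, \<mu> m) \<in> man_pref S m \<and> (m, inv_into (men S) \<mu> w) \<in> woman_pref S w"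

definition Stab :: "('m, 'w) profile \<Rightarrow> ('m \<Rightarrow> 'w) set" where
  "Stab S = {\<mu> \<in> matchings S. \<nexists>m w. blocks S \<mu> m w}"

text \<open>The strict preference relation described by a list, most preferred element first.\<close>

definition list_pref :: "'a list \<Rightarrow> 'a rel" where
  "list_pref xs = {(xs ! i, xs ! j) | i j. i < j \<and> j < length xs}"

definition is_ordering :: "('a, 'b) monoid_scheme \<Rightarrow> 'a list \<Rightarrow> bool" where
  "is_ordering G A \<longleftrightarrow> distinct A \<and> set A = carrier G"

text \<open>The man \<open>m\<^sub>g\<close> and the woman \<open>w\<^sub>g\<close> are both represented by the group element \<open>g\<close>.\<close>

definition antiphase_template :: "('a, 'b) monoid_scheme \<Rightarrow> 'a list \<Rightarrow> ('a, 'a) profile" where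
  "antiphase_template G A =
     \<lparr>men = carrier G, women = carrier G,
      man_pref = (\<lambda>g. list_pref (map (\<lambda>a. g \<otimes>\<^bsub>G\<^esub> a) A)),
      woman_pref = (\<lambda>h. list_pref (map (\<lambda>a. h \<otimes>\<^bsub>G\<^esub> inv\<^bsub>G\<^esub> a) (rev A)))\<rparr>"

definition subgroup_index :: "('a, 'b) monoid_scheme \<Rightarrow> 'a set \<Rightarrow> nat" where
  "subgroup_index G H = card (rcosets\<^bsub>G\<^esub> H)"

lemma list_pref_subset: "list_pref xs \<subseteq> set xs \<times> set xs"
  by (auto simp: list_pref_def)

lemma strict_linear_order_list_pref:
  assumes "distinct xs"
  shows "strict_linear_order_on (set xs) (list_pref xs)"
proof -
  have "trans (list_pref xs)"
  proof (rule transI)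
    fix x y z assume "(x, y) \<in> list_pref xs" "(y, z) \<in> list_pref xs"
    then obtain i j k l where *: "i < j" "j < length xs" "x = xs ! i" "y = xs ! j"
        "k < l" "l < length xs" "y = xs ! k" "z = xs ! l"
      by (auto simp: list_pref_def)
    moreover have "j = k"
      using * assms nth_eq_iff_index_eq[of xs j k] by simp
    ultimately show "(x, z) \<in> list_pref xs"
      unfolding list_pref_def using less_trans by blast
  qed
  moreover have "irrefl (list_pref xs)"
    using assms by (auto simp: irrefl_def list_pref_def nth_eq_iff_index_eq)
  moreover have "total_on (set xs) (list_pref xs)"
  proof (rule total_onI)
    fix x y assume "x \<in> set xs" "y \<in> set xs" "x \<noteq> y"
    then obtain i j where *: "i < length xs" "j < length xs" "x = xs ! i" "y = xs ! j" "i \<noteq> j"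
      by (auto simp: in_set_conv_nth)
    then have "i < j \<or> j < i" by linarith
    with * show "(x, y) \<in> list_pref xs \<or> (y, x) \<in> list_pref xs"
      unfolding list_pref_def by blast
  qed
  ultimately show ?thesis
    by (simp add: strict_linear_order_on_def)
qed

lemma (in group) strict_complete_profile_antiphase_template:
  assumes A: "is_ordering G A"
  shows "strict_complete_profile (antiphase_template G A)"
proof -
  have dA: "distinct A" and sA: "set A = carrier G"
    using A by (auto simp: is_ordering_def)
  have man: "distinct (map (\<lambda>a. g \<otimes> a) A)" "set (map (\<lambda>a. g \<otimes> a) A) = carrier G"
    if g: "g \<in> carrier G" for g
  proof -
    show "distinct (map (\<lambda>a. g \<otimes> a) A)"
      using g by (auto simp: distinct_map dA sA inj_on_def)
    have "x \<in> (\<lambda>a. g \<otimes> a) ` carrier G" if "x \<in> carrier G" for x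
      using g that by (intro image_eqI[of _ _ "inv g \<otimes> x"]) (auto simp: m_assoc[symmetric])
    then show "set (map (\<lambda>a. g \<otimes> a) A) = carrier G"
      using g by (auto simp: sA)
  qed
  have woman: "distinct (map (\<lambda>a. h \<otimes> inv a) (rev A))"
      "set (map (\<lambda>a. h \<otimes> inv a) (rev A)) = carrier G"
    if h: "h \<in> carrier G" for h
  proof -
    show "distinct (map (\<lambda>a. h \<otimes> inv a) (rev A))"
      using h by (auto simp: distinct_map dA sA inj_on_def)
    have "x \<in> (\<lambda>a. h \<otimes> inv a) ` carrier G" if "x \<in> carrier G" for x
      using h that
      by (intro image_eqI[of _ _ "inv x \<otimes> h"]) (auto simp: inv_mult_group m_assoc[symmetric])
    then show "set (map (\<lambda>a. h \<otimes> inv a) (rev A)) = carrier G"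
      using h by (auto simp: sA)
  qed
  have "finite (carrier G)"
    using sA by (metis List.finite_set)
  moreover have "list_pref (map (\<lambda>a. g \<otimes> a) A) \<subseteq> carrier G \<times> carrier G \<and>
      strict_linear_order_on (carrier G) (list_pref (map (\<lambda>a. g \<otimes> a) A))"
    if "g \<in> carrier G" for g
    using list_pref_subset[of "map (\<lambda>a. g \<otimes> a) A"]
      strict_linear_order_list_pref[OF man(1)[OF that]] unfolding man(2)[OF that] by blast
  moreover have "list_pref (map (\<lambda>a. h \<otimes> inv a) (rev A)) \<subseteq> carrier G \<times> carrier G \<and>
      strict_linear_order_on (carrier G) (list_pref (map (\<lambda>a. h \<otimes> inv a) (rev A)))"
    if "h \<in> carrier G" for h
    using list_pref_subset[of "map (\<lambda>a. h \<otimes> inv a) (rev A)"]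
      strict_linear_order_list_pref[OF woman(1)[OF that]] unfolding woman(2)[OF that] by blast
  ultimately show ?thesis
    by (simp add: strict_complete_profile_def antiphase_template_def)
qed

end

theory Submission
  imports Defs
begin

text \<open>
  The man \<open>m\<^sub>g\<close> ranks \<open>w\<^sub>h\<close> in position \<open>k\<close>, where \<open>h = g a\<^sub>k\<close>, exactly when \<open>w\<^sub>h\<close> ranks \<open>m\<^sub>g\<close> in
  position \<open>n - 1 - k\<close>.  Describe a matching by the position \<open>r g\<close> that \<open>m\<^sub>g\<close> assigns to his partner.
  A blocking pair at position \<open>k\<close> then needs \<open>r g' < k < r g\<close> for some \<open>g, g'\<close>, so every matching
  whose positions all lie in \<open>{b - 1, b}\<close> is stable.  Sending the men in \<open>T\<close> to position \<open>b\<close> and all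
  others to position \<open>b - 1\<close> is injective if \<open>T\<close> is a union of left cosets of \<open>\<langle>q\<^sub>b\<rangle>\<close>.
  There are \<open>2\<close> to the power \<open>[G : \<langle>q\<^sub>b\<rangle>]\<close> such sets \<open>T\<close>, and all but two of them use both positions,
  so the resulting matchings are distinct for distinct \<open>b\<close>; the \<open>n\<close> constant position functions
  give the remaining matchings.
\<close>

section \<open>List preferences under relabelling and reversal\<close>

lemma list_pref_nth_iff:
  assumes "distinct xs" "i < length xs" "j < length xs"
  shows "(xs ! i, xs ! j) \<in> list_pref xs \<longleftrightarrow> i < j"
  using assms by (fastforce simp: list_pref_def nth_eq_iff_index_eq)

lemma list_pref_map_iff:
  assumes "inj_on f (set xs)" "x \<in> set xs" "y \<in> set xs"
  shows "(f x, f y) \<in> list_pref (map f xs) \<longleftrightarrow> (x, y) \<in> list_pref xs"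
proof
  assume "(f x, f y) \<in> list_pref (map f xs)"
  then obtain i j where ij: "i < j" "j < length xs" "f x = f (xs ! i)" "f y = f (xs ! j)"
    by (auto simp: list_pref_def)
  then have "x = xs ! i" "y = xs ! j"
    using assms by (auto simp: inj_on_def)
  with ij show "(x, y) \<in> list_pref xs"
    by (auto simp: list_pref_def)
next
  assume "(x, y) \<in> list_pref xs"
  then show "(f x, f y) \<in> list_pref (map f xs)"
    by (force simp: list_pref_def)
qed

lemma list_pref_rev: "list_pref (rev xs) = (list_pref xs)\<inverse>"
proof -
  have "list_pref (rev ys) \<subseteq> (list_pref ys)\<inverse>" for ys :: "'a list"
  proof
    fix p assume "p \<in> list_pref (rev ys)"
    then obtain i j where ij: "i < j" "j < length ys"
        "p = (ys ! (length ys - Suc i), ys ! (length ys - Suc j))"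
      by (auto simp: list_pref_def rev_nth)
    moreover have "length ys - Suc j < length ys - Suc i" "length ys - Suc i < length ys"
      using ij by auto
    ultimately show "p \<in> (list_pref ys)\<inverse>"
      unfolding list_pref_def by blast
  qed
  from this[of xs] this[of "rev xs"] show ?thesis
    by auto
qed

section \<open>Matchings described by position functions\<close>

definition position_matching :: "('a, 'b) monoid_scheme \<Rightarrow> 'a list \<Rightarrow> ('a \<Rightarrow> nat) \<Rightarrow> 'a \<Rightarrow> 'a" where
  "position_matching G A r = (\<lambda>g\<in>carrier G. g \<otimes>\<^bsub>G\<^esub> A ! r g)"

text \<open>For a subgroup \<open>H\<close>, two elements lie in the same left coset iff their
  inverses lie in the same right coset. Testing \<open>H #> inv g\<close> thus lets subsets of
  \<open>rcosets H\<close>, the cosets counted by \<open>subgroup_index\<close>, encode unions of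
  left cosets.\<close>

definition coset_position :: "('a, 'b) monoid_scheme \<Rightarrow> 'a set \<Rightarrow> nat \<Rightarrow> 'a set set \<Rightarrow> 'a \<Rightarrow> nat" where
  "coset_position G H b \<C> = (\<lambda>g\<in>carrier G. if H #>\<^bsub>G\<^esub> inv\<^bsub>G\<^esub> g \<in> \<C> then b else b - 1)"

context group
begin

text \<open>Cancelling \<open>g\<close> and using distinctness of \<open>A\<close> recovers
  \<open>r g\<close>. This lets matchings be counted through position functions.\<close>

lemma inj_on_position_matching:
  assumes A: "is_ordering G A"
  shows "inj_on (position_matching G A) (carrier G \<rightarrow>\<^sub>E {..<length A})"
proof (rule inj_onI)
  fix r s assume r: "r \<in> carrier G \<rightarrow>\<^sub>E {..<length A}" and s: "s \<in> carrier G \<rightarrow>\<^sub>E {..<length A}"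
    and eq: "position_matching G A r = position_matching G A s"
  show "r = s"
  proof (rule PiE_ext[OF r s])
    fix g assume g: "g \<in> carrier G"
    have lt: "r g < length A" "s g < length A"
      using g r s by auto
    then have "A ! r g \<in> carrier G" "A ! s g \<in> carrier G"
      using A nth_mem[of "r g" A] nth_mem[of "s g" A] by (simp_all add: is_ordering_def)
    moreover have "g \<otimes> A ! r g = g \<otimes> A ! s g"
      using fun_cong[OF eq, of g] g by (simp add: position_matching_def)
    ultimately have "A ! r g = A ! s g"
      using g by simp
    then show "r g = s g"
      using A lt by (simp add: is_ordering_def nth_eq_iff_index_eq)
  qed
qed

lemma position_matching_in_Stab:
  assumes A: "is_ordering G A"
    and r: "\<And>g. g \<in> carrier G \<Longrightarrow> r g < length A"
    and close: "\<And>g g'. g \<in> carrier G \<Longrightarrow> g' \<in> carrier G \<Longrightarrow> r g \<le> Suc (r g')"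
    and inj: "inj_on (position_matching G A r) (carrier G)"
  shows "position_matching G A r \<in> Stab (antiphase_template G A)"
proof -
  let ?\<mu> = "position_matching G A r"
  have dA: "distinct A" and sA: "set A = carrier G"
    using A by (auto simp: is_ordering_def)
  have nth: "A ! i \<in> carrier G" if "i < length A" for i
    using nth_mem[OF that] sA by simp
  have "finite (carrier G)"
    using sA by (metis List.finite_set)
  moreover have "?\<mu> ` carrier G \<subseteq> carrier G"
    using r nth by (auto simp: position_matching_def)
  ultimately have bij: "bij_betw ?\<mu> (carrier G) (carrier G)"
    using inj by (simp add: bij_betw_def endo_inj_surj)
  have False if bl: "blocks (antiphase_template G A) ?\<mu> g h" for g h
  proof -
    have g: "g \<in> carrier G" and h: "h \<in> carrier G"
      and man: "(h, ?\<mu> g) \<in> list_pref (map (\<lambda>a. g \<otimes> a) A)"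
      and woman: "(g, inv_into (carrier G) ?\<mu> h) \<in> list_pref (map (\<lambda>a. h \<otimes> inv a) (rev A))"
      using bl by (auto simp: blocks_def antiphase_template_def)
    define g' where "g' = inv_into (carrier G) ?\<mu> h"
    have g': "g' \<in> carrier G" and \<mu>g': "?\<mu> g' = h"
      using bij h unfolding g'_def
      by (auto simp: bij_betw_def inv_into_into f_inv_into_f)
    \<comment> \<open>The index \<open>k\<close> found here is the position of \<open>h\<close> in
      the list of \<open>g\<close>.\<close>
    have "inv g \<otimes> h \<in> set A"
      using g h sA by simp
    then obtain k where k: "k < length A" "A ! k = inv g \<otimes> h"
      by (auto simp: in_set_conv_nth)
    have hk: "h = g \<otimes> A ! k"
      using k g h by (simp add: m_assoc[symmetric])
    have hg': "h = g' \<otimes> A ! r g'"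
      using \<mu>g' g' by (simp add: position_matching_def)
    have gk: "g = h \<otimes> inv (A ! k)"
      using g nth[OF k(1)] unfolding hk by (simp add: m_assoc)
    have g'k: "g' = h \<otimes> inv (A ! r g')"
      using g' nth[OF r[OF g']] by (subst hg') (simp add: m_assoc)
    have "(g \<otimes> A ! k, g \<otimes> A ! r g) \<in> list_pref (map (\<lambda>a. g \<otimes> a) A)"
      using man g hk by (simp add: position_matching_def)
    then have "(A ! k, A ! r g) \<in> list_pref A"
      using g k(1) r[OF g] by (subst (asm) list_pref_map_iff) (auto simp: inj_on_def sA nth)
    then have 1: "k < r g"
      using dA k(1) r[OF g] by (simp add: list_pref_nth_iff)
    \<comment> \<open>The women's lists are reversed, so \<open>h\<close> favours men who rank her
      at larger positions: preferring \<open>g\<close> to her partner \<open>g'\<close> means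
      \<open>r g' < k\<close>.\<close>
    have "(h \<otimes> inv (A ! k), h \<otimes> inv (A ! r g')) \<in> list_pref (map (\<lambda>a. h \<otimes> inv a) (rev A))"
      using woman gk g'k unfolding g'_def[symmetric] by simp
    then have "(A ! k, A ! r g') \<in> list_pref (rev A)"
      using h k(1) r[OF g'] by (subst (asm) list_pref_map_iff) (auto simp: inj_on_def sA nth)
    then have "r g' < k"
      using dA k(1) r[OF g'] by (simp add: list_pref_rev list_pref_nth_iff)
    with 1 close[OF g g'] show False
      by simp
  qed
  then show ?thesis
    using bij by (auto simp: Stab_def matchings_def antiphase_template_def position_matching_def)
qed

section \<open>Position functions that yield bijections\<close>

lemma inj_on_const_position_matching:
  assumes "A ! k \<in> carrier G"
  shows "inj_on (position_matching G A (\<lambda>g\<in>carrier G. k)) (carrier G)"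
  using assms by (auto simp: inj_on_def position_matching_def)

text \<open>Equal positions cannot collide, by cancellation. If \<open>g\<close> at position
  \<open>b\<close> met \<open>g'\<close> at position \<open>b - 1\<close>, then
  \<open>inv g'\<close> would be the element of \<open>H\<close> in \<open>q\<close> times
  \<open>inv g\<close>; both men would then have the same coset, so \<open>\<C>\<close> could not
  separate them.\<close>

lemma inj_on_coset_position_matching:
  assumes a: "A ! b \<in> carrier G" "A ! (b - 1) \<in> carrier G"
    and H: "subgroup H G" and q: "A ! (b - 1) \<otimes> inv (A ! b) \<in> H"
  shows "inj_on (position_matching G A (coset_position G H b \<C>)) (carrier G)"
proof -
  have coset_eq: "H #> inv g' = H #> inv g"
    if g: "g \<in> carrier G" "g' \<in> carrier G" and eq: "g \<otimes> A ! b = g' \<otimes> A ! (b - 1)" for g g'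
  proof -
    have "g' = (g \<otimes> A ! b) \<otimes> inv (A ! (b - 1))"
      unfolding eq using a g by (simp add: m_assoc)
    then have "inv g' = (A ! (b - 1) \<otimes> inv (A ! b)) \<otimes> inv g"
      using a g by (simp add: inv_mult_group m_assoc)
    then have "H #> inv g' = (H #> (A ! (b - 1) \<otimes> inv (A ! b))) #> inv g"
      using a g subgroup.subset[OF H] by (simp add: coset_mult_assoc)
    also have "\<dots> = H #> inv g"
      using q H a by (simp add: coset_join2)
    finally show ?thesis .
  qed
  show ?thesis
  proof (rule inj_onI)
    fix g g' assume g: "g \<in> carrier G" "g' \<in> carrier G"
      and eq: "position_matching G A (coset_position G H b \<C>) g =
               position_matching G A (coset_position G H b \<C>) g'"
    then show "g = g'"
      using a coset_eq[of g g'] coset_eq[of g' g]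
      by (auto simp: position_matching_def coset_position_def split: if_splits)
  qed
qed

text \<open>A nonempty proper \<open>\<C>\<close> has a coset inside and one outside, so both
  positions occur. The range later identifies \<open>b\<close>.\<close>

lemma image_coset_position:
  assumes H: "subgroup H G" and C: "\<C> \<subseteq> rcosets H" "\<C> \<noteq> {}" "\<C> \<noteq> rcosets H"
  shows "coset_position G H b \<C> ` carrier G = {b - 1, b}"
proof -
  \<comment> \<open>The witness is the inverse of any representative of \<open>U\<close>.\<close>
  have *: "\<exists>g\<in>carrier G. U = H #> inv g" if "U \<in> rcosets H" for U
    using that by (auto simp: RCOSETS_def) (metis inv_closed inv_inv)
  obtain U V where "U \<in> \<C>" "V \<in> rcosets H" "V \<notin> \<C>"
    using C by auto
  moreover from this have "U \<in> rcosets H"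
    using C by auto
  ultimately obtain g g' where "g \<in> carrier G" "H #> inv g \<in> \<C>" "g' \<in> carrier G" "H #> inv g' \<notin> \<C>"
    using * by metis
  then have "b \<in> coset_position G H b \<C> ` carrier G" "b - 1 \<in> coset_position G H b \<C> ` carrier G"
    by (force simp: coset_position_def)+
  then show ?thesis
    by (auto simp: coset_position_def)
qed

text \<open>With \<open>0 < b\<close> the natural number \<open>b - 1\<close> differs from
  \<open>b\<close>, so the value at \<open>inv x\<close> reveals whether \<open>H #> x\<close>
  belongs to \<open>\<C>\<close>.\<close>

lemma inj_on_coset_position:
  assumes "0 < b"
  shows "inj_on (coset_position G H b) (Pow (rcosets H))"
proof (rule inj_onI)
  fix \<C> \<D> assume C: "\<C> \<in> Pow (rcosets H)" "\<D> \<in> Pow (rcosets H)"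
    and eq: "coset_position G H b \<C> = coset_position G H b \<D>"
  have "U \<in> \<C> \<longleftrightarrow> U \<in> \<D>" if U: "U \<in> rcosets H" for U
  proof -
    obtain x where x: "x \<in> carrier G" "U = H #> x"
      using U by (auto simp: RCOSETS_def)
    then show ?thesis
      using fun_cong[OF eq, of "inv x"] assms
      by (auto simp: coset_position_def split: if_splits)
  qed
  then show "\<C> = \<D>"
    using C by blast
qed

lemma card_coset_positions:
  assumes fin: "finite (carrier G)" and H: "subgroup H G" and b: "0 < b"
  shows "int (card (coset_position G H b ` (Pow (rcosets H) - {{}, rcosets H}))) =
    2 ^ subgroup_index G H - 2"
proof -
  have fr: "finite (rcosets H)"
    using fin by (simp add: RCOSETS_def)
  have ne: "rcosets H \<noteq> {}"
    by (auto simp: RCOSETS_def)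
  have "card (coset_position G H b ` (Pow (rcosets H) - {{}, rcosets H})) =
      card (Pow (rcosets H) - {{}, rcosets H})"
    using inj_on_coset_position[OF b] by (intro card_image) (blast intro: inj_on_subset)
  also have "\<dots> = card (Pow (rcosets H)) - card {{}, rcosets H}"
    using fr by (intro card_Diff_subset) auto
  also have "\<dots> = 2 ^ card (rcosets H) - 2"
    using fr ne by (simp add: card_Pow)
  \<comment> \<open>Since \<open>rcosets H\<close> is nonempty, the power is at least 2 and the
    truncated subtraction agrees with the integer one.\<close>
  finally show ?thesis
    using fr ne self_le_power[of "2::nat" "card (rcosets H)"]
    by (simp add: subgroup_index_def of_nat_diff card_gt_0_iff)
qed

end

theorem theorem5p8:
  fixes G :: "('a, 'b) monoid_scheme" and n :: nat and A :: "'a list" and q :: "nat \<Rightarrow> 'a"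
  assumes "group G" and "finite (carrier G)" and "order G = n"
    and "is_ordering G A"
    and "\<And>b. b \<in> {1..<n} \<Longrightarrow> q b = A ! (b - 1) \<otimes>\<^bsub>G\<^esub> inv\<^bsub>G\<^esub> (A ! b)"
  shows "int (card (Stab (antiphase_template G A))) \<ge>
           int n + (\<Sum>b\<in>{1..<n}. ((2::int) ^ subgroup_index G (generate G {q b}) - 2))"
proof -
  interpret group G by fact
  note fin = assms(2) and A = assms(4) and q = assms(5)
  have len: "length A = n"
    using A assms(3) by (metis distinct_card is_ordering_def order_def)
  have nth: "A ! i \<in> carrier G" if "i < n" for i
    using that A len by (metis is_ordering_def nth_mem)
  define H where "H b = generate G {q b}" for b
  \<comment> \<open>The two subsets left out give the constant functions \<open>b - 1\<close> and
    \<open>b\<close>, which \<open>K\<close> already contains; hence the \<open>- 2\<close> in each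
    summand.\<close>
  define P where "P b = coset_position G (H b) b ` (Pow (rcosets\<^bsub>G\<^esub> H b) - {{}, rcosets\<^bsub>G\<^esub> H b})" for b
  define K where "K = (\<lambda>k. \<lambda>g\<in>carrier G. k) ` {..<n}"
  have qc: "q b \<in> carrier G" if "b \<in> {1..<n}" for b
    using that q[OF that] nth by auto
  have H: "subgroup (H b) G" if "b \<in> {1..<n}" for b
    unfolding H_def using qc[OF that] by (intro generate_is_subgroup) simp
  have qH: "A ! (b - 1) \<otimes>\<^bsub>G\<^esub> inv\<^bsub>G\<^esub> (A ! b) \<in> H b" if "b \<in> {1..<n}" for b
    unfolding H_def q[OF that, symmetric] by (auto intro: generate.incl)
  have range_P: "r ` carrier G = {b - 1, b}" if "b \<in> {1..<n}" "r \<in> P b" for b r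
    using that(2) image_coset_position[OF H[OF that(1)]] by (auto simp only: P_def)
  have range_K: "\<exists>k. r ` carrier G = {k}" if "r \<in> K" for r
    using that by (auto simp: K_def image_constant[OF one_closed])
  have inj_K: "inj_on (\<lambda>k. \<lambda>g\<in>carrier G. k) {..<n}"
    by (rule inj_onI) (metis one_closed restrict_apply')
  have fin_P: "finite (P b)" for b
    using fin by (auto simp: P_def RCOSETS_def)
  have disj_P: "P b \<inter> P c = {}" if "b \<in> {1..<n}" "c \<in> {1..<n}" "b \<noteq> c" for b c
  proof (rule ccontr)
    assume "P b \<inter> P c \<noteq> {}"
    \<comment> \<open>Both sets are the range of a common element, and the larger entry of the range
      determines the index.\<close>
    then have "{b - 1, b} = {c - 1, c}"
      using that range_P by blast
    then show False
      using that by (auto simp: doubleton_eq_iff)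
  qed
  have disj_K: "K \<inter> (\<Union>b\<in>{1..<n}. P b) = {}"
  proof (rule ccontr)
    assume "K \<inter> (\<Union>b\<in>{1..<n}. P b) \<noteq> {}"
    then obtain r b where r: "r \<in> K" "b \<in> {1..<n}" "r \<in> P b"
      by blast
    then obtain k where "{k} = {b - 1, b}"
      using range_P range_K by metis
    then have "b - 1 = b"
      by auto
    then show False
      using r(2) by auto
  qed
  have "int (card (K \<union> (\<Union>b\<in>{1..<n}. P b))) = int (card K) + (\<Sum>b\<in>{1..<n}. int (card (P b)))"
    using disj_P fin_P disj_K by (subst card_Un_disjoint) (auto simp: K_def card_UN_disjoint)
  also have "card K = n"
    using inj_K by (simp add: K_def card_image)
  also have "(\<Sum>b\<in>{1..<n}. int (card (P b))) = (\<Sum>b\<in>{1..<n}. 2 ^ subgroup_index G (H b) - 2)"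
    unfolding P_def by (intro sum.cong refl card_coset_positions fin H) auto
  finally have card: "int (card (K \<union> (\<Union>b\<in>{1..<n}. P b))) =
    int n + (\<Sum>b\<in>{1..<n}. 2 ^ subgroup_index G (H b) - 2)" .
  \<comment> \<open>This is the function space on which \<open>position_matching G A\<close> was
    shown injective.\<close>
  have sub: "K \<union> (\<Union>b\<in>{1..<n}. P b) \<subseteq> carrier G \<rightarrow>\<^sub>E {..<length A}"
    by (auto simp: len K_def P_def coset_position_def simp del: Diff_iff split: if_splits)
  have "position_matching G A r \<in> Stab (antiphase_template G A)" if r: "r \<in> K" for r
  proof -
    obtain k where k: "k < n" "r = (\<lambda>g\<in>carrier G. k)"
      using r by (auto simp: K_def)
    then show ?thesis
      using nth
      by (intro position_matching_in_Stab A) (auto intro: inj_on_const_position_matching simp: len)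
  qed
  moreover have "position_matching G A r \<in> Stab (antiphase_template G A)"
    if b: "b \<in> {1..<n}" and r: "r \<in> P b" for b r
  proof (rule position_matching_in_Stab[OF A])
    have r_cases: "r g = b - 1 \<or> r g = b" if "g \<in> carrier G" for g
      using range_P[OF b r] that by blast
    show "r g < length A" if "g \<in> carrier G" for g
      using r_cases[OF that] b len by auto
    show "r g \<le> Suc (r g')" if "g \<in> carrier G" "g' \<in> carrier G" for g g'
      using r_cases[OF that(1)] r_cases[OF that(2)] by auto
    show "inj_on (position_matching G A r) (carrier G)"
      using r b inj_on_coset_position_matching[OF nth nth H[OF b] qH[OF b]]
      by (auto simp: P_def simp del: Diff_iff)
  qed
  ultimately have img: "position_matching G A ` (K \<union> (\<Union>b\<in>{1..<n}. P b)) \<subseteq> Stab (antiphase_template G A)"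
    by blast
  \<comment> \<open>Infinite sets have \<open>card\<close> 0, so the comparison of cardinalities
    requires finiteness of the target.\<close>
  have "finite (Stab (antiphase_template G A))"
  proof (rule finite_subset)
    show "Stab (antiphase_template G A) \<subseteq> carrier G \<rightarrow>\<^sub>E carrier G"
      by (auto simp: Stab_def matchings_def antiphase_template_def PiE_def bij_betw_def)
    show "finite (carrier G \<rightarrow>\<^sub>E carrier G)"
      using fin by (simp add: finite_PiE)
  qed
  from card_inj_on_le[OF inj_on_subset[OF inj_on_position_matching[OF A] sub] img this]
  show ?thesis
    using card by (simp add: H_def)
qed

end
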